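(* Let $\mathbf P\in\mathbb R^{k\times d}$ be separable with row partition $\alpha_1,\dots,\alpha_l$ of $\{1,\dots,k\}$ and column partition $\beta_1,\dots,\beta_l$ of $\{1,\dots,d\}$. Put $k_i=|\alpha_i|$, $d_i=|\beta_i|$ and $\mathbf P_i=\mathbf P[\alpha_i,\beta_i]\in\mathbb R^{k_i\times d_i}$ for $i=1,\dots,l$. Let $\mathcal A_i\subset\mathbb R^{(d_i+1)\times(d_i+1)}$, $i=1,\dots,l$, be arbitrary sets. Then the following two sets of matrices are equal: (1) the set of all $\begin{bmatrix}1&y^{\mathsf T}\\ y&\mathbf Y\end{bmatrix}\in\mathbb S_+^{k+1}$ (with $y\in\mathbb R^k$, $\mathbf Y\in\mathbb R^{k\times k}$) for which there exist $t\in\mathbb R^d$ and $\mathbf T\in\mathbb R^{d\times d}$ such that $$\mathbf Y=\mathbf P\mathbf T\mathbf P^{\mathsf T},\quad y=\mathbf Pt,\quad \begin{bmatrix}1&t^{\mathsf T}\\ t&\mathbf T\end{bmatrix}\in\mathbb S_+^{d+1},\quad \begin{bmatrix}1&t[\beta_i]^{\mathsf T}\\ t[\beta_i]&\mathbf T[\beta_i]\end{bmatrix}\in\mathcal A_i,\ i=1,\dots,l;$$ (2) the set of all $\begin{bmatrix}1&y^{\mathsf T}\\ y&\mathbf Y\end{bmatrix}\in\mathbb S_+^{k+1}$ (with $y\in\mathbb R^k$, $\mathbf Y\in\mathbb R^{k\times k}$) for which there exist $t^{(i)}\in\mathbb R^{d_i}$ and $\mathbf T^{(i)}\in\mathbb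 R^{d_i\times d_i}$, $i=1,\dots,l$, such that for every $i=1,\dots,l$ $$\mathbf Y[\alpha_i]=\mathbf P_i\mathbf T^{(i)}\mathbf P_i^{\mathsf T},\quad y[\alpha_i]=\mathbf P_it^{(i)},\quad \begin{bmatrix}1&(t^{(i)})^{\mathsf T}\\ t^{(i)}&\mathbf T^{(i)}\end{bmatrix}\in\mathbb S_+^{d_i+1},\quad \begin{bmatrix}1&(t^{(i)})^{\mathsf T}\\ t^{(i)}&\mathbf T^{(i)}\end{bmatrix}\in\mathcal A_i .$$
   Context: $\mathbb S_+^p$ is the cone of real symmetric positive semidefinite $p\times p$ matrices. For a matrix $\mathbf A$ and index sets $\alpha,\beta$, $\mathbf A[\alpha,\beta]$ is the submatrix with rows indexed by $\alpha$ and columns indexed by $\beta$; $\mathbf A[\alpha]=\mathbf A[\alpha,\alpha]$; for a vector $u$, $u[\alpha]$ is the subvector indexed by $\alpha$. $|\alpha|$ is the cardinality of $\alpha$. A matrix $\mathbf P\in\mathbb R^{k\times d}$ is called separable (with row partition $\alpha_1,\dots,\alpha_l$ and column partition $\beta_1,\dots,\beta_l$) if $\alpha_1,\dots,\alpha_l$ is a partition of the row indices $\{1,\dots,k\}$, $\beta_1,\dots,\beta_l$ is a partition of the column indices $\{1,\dots,d\}$, and $\mathbf P[\alpha_i,\beta_j]=\mathbf 0$ for all $i\ne j$. *)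

theory Defs
  imports Complex_Main "HOL-Library.Disjoint_Sets" "Jordan_Normal_Form.DL_Submatrix"
begin

(* Row and column indices are 0-based, as in Jordan_Normal_Form: {1,...,n} is {0..<n} here. *)

definition psd_cone :: "nat \<Rightarrow> real mat set" where
  "psd_cone p = {A \<in> carrier_mat p p.
     transpose_mat A = A \<and> (\<forall>x \<in> carrier_vec p. x \<bullet> (A *\<^sub>v x) \<ge> 0)}"

(* Vector analogue of submatrix: as there, the selected indices keep their increasing order,
   pick I i being the i-th smallest element of I. *)
definition subvec :: "'a vec \<Rightarrow> nat set \<Rightarrow> 'a vec" where
  "subvec v I = vec (card {i. i < dim_vec v \<and> i \<in> I}) (\<lambda>i. v $ pick I i)"

(* The block matrix [1, v^T; v, M]. *)
definition bordered :: "real vec \<Rightarrow> real mat \<Rightarrow> real mat" where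
  "bordered v M = four_block_mat (1\<^sub>m 1) (mat_of_row v) (transpose_mat (mat_of_row v)) M"

(* An indexed partition into l blocks. Blocks are nonempty (part of partition_on); injectivity
   makes blocks with different indices different, hence disjoint. *)
definition indexed_partition :: "nat set \<Rightarrow> nat \<Rightarrow> (nat \<Rightarrow> nat set) \<Rightarrow> bool" where
  "indexed_partition S l \<alpha> \<longleftrightarrow> partition_on S (\<alpha> ` {..<l}) \<and> inj_on \<alpha> {..<l}"

definition separable :: "real mat \<Rightarrow> nat \<Rightarrow> (nat \<Rightarrow> nat set) \<Rightarrow> (nat \<Rightarrow> nat set) \<Rightarrow> bool" where
  "separable P l \<alpha> \<beta> \<longleftrightarrow>
     indexed_partition {0..<dim_row P} l \<alpha> \<and>
     indexed_partition {0..<dim_col P} l \<beta> \<and>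
     (\<forall>i<l. \<forall>j<l. i \<noteq> j \<longrightarrow>
        submatrix P (\<alpha> i) (\<beta> j) = 0\<^sub>m (card (\<alpha> i)) (card (\<beta> j)))"

end

theory Submission
  imports Defs
begin

text \<open>By Schur complements, \<open>bordered y Y\<close> is positive semidefinite iff \<open>Z = Y - y y\<^sup>T\<close> is. Given
  local solutions \<open>(t i, T i)\<close>, let \<open>D\<close> be the block diagonal matrix with blocks
  \<open>T i - (t i) (t i)\<^sup>T\<close> and let \<open>W\<close> be the block diagonal part of \<open>Z\<close>, so that \<open>W = P D P\<^sup>T\<close>. As \<open>D\<close>
  is semidefinite, the kernel of \<open>W\<close> is contained in that of \<open>D P\<^sup>T\<close>, hence \<open>K W = D P\<^sup>T\<close> for some
  block diagonal \<open>K\<close>. Then \<open>(P K - 1) W = 0\<close>, and semidefiniteness of \<open>Z\<close> upgrades this to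
  \<open>(P K - 1) Z = 0\<close>. The matrix \<open>S = K Z K\<^sup>T + (1 - K P) D (1 - K P)\<^sup>T\<close> is semidefinite, satisfies
  \<open>P S P\<^sup>T = Z\<close> and has the diagonal blocks of \<open>D\<close>, because its second summand equals
  \<open>D - K W K\<^sup>T\<close>. The global solution is \<open>T = S + t t\<^sup>T\<close>.\<close>

subsection \<open>The semidefinite cone\<close>

text \<open>Induction on \<open>I\<close>: if dropping the constraint \<open>m\<close> admits some \<open>x\<close> with \<open>w(x) \<noteq> 0\<close>, then
  \<open>w - c a\<^sub>m\<close> with \<open>c = w(x) / a\<^sub>m(x)\<close> is in the span of the remaining functionals.\<close>

lemma functional_in_span:
  fixes a :: "'i \<Rightarrow> 'j \<Rightarrow> real" and w :: "'j \<Rightarrow> real"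
  assumes "finite I"
    and "\<And>v. (\<And>i. i \<in> I \<Longrightarrow> (\<Sum>j\<in>J. a i j * v j) = 0) \<Longrightarrow> (\<Sum>j\<in>J. w j * v j) = 0"
    and "finite J"
  shows "\<exists>u. \<forall>j\<in>J. w j = (\<Sum>i\<in>I. u i * a i j)"
  using assms
proof (induction I arbitrary: w rule: finite_induct)
  case empty
  \<comment> \<open>With no constraint every vector is admissible, so \<open>w\<close> can be tested
    against itself; a vanishing sum of squares makes it zero on \<open>J\<close>.\<close>
  have "(\<Sum>j\<in>J. w j * w j) = 0" using empty by auto
  then have "\<forall>j\<in>J. w j * w j = 0"
    using \<open>finite J\<close> by (subst (asm) sum_nonneg_eq_0_iff) auto
  then show ?case by auto
next
  case (insert m I)
  show ?case
  proof (cases "\<forall>v. (\<forall>i\<in>I. (\<Sum>j\<in>J. a i j * v j) = 0) \<longrightarrow> (\<Sum>j\<in>J. w j * v j) = 0")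
    case True
    then obtain u where u: "\<forall>j\<in>J. w j = (\<Sum>i\<in>I. u i * a i j)"
      using insert.IH[of w] insert.prems by blast
    have "(\<Sum>i\<in>insert m I. (u(m := 0)) i * a i j) = (\<Sum>i\<in>I. u i * a i j)" for j
      using insert.hyps by (simp add: sum.insert) (intro sum.cong, auto)
    then show ?thesis using u by (intro exI[of _ "u(m := 0)"]) auto
  next
    case False
    then obtain x where x: "\<And>i. i \<in> I \<Longrightarrow> (\<Sum>j\<in>J. a i j * x j) = 0"
      and wx: "(\<Sum>j\<in>J. w j * x j) \<noteq> 0" by blast
    have mx: "(\<Sum>j\<in>J. a m j * x j) \<noteq> 0"
      using insert.prems(1)[of x] x wx by blast
    define c where "c = (\<Sum>j\<in>J. w j * x j) / (\<Sum>j\<in>J. a m j * x j)"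
    have "\<exists>u. \<forall>j\<in>J. w j - c * a m j = (\<Sum>i\<in>I. u i * a i j)"
    proof (rule insert.IH)
      fix v assume v: "\<And>i. i \<in> I \<Longrightarrow> (\<Sum>j\<in>J. a i j * v j) = 0"
      \<comment> \<open>With this multiple \<open>v - s x\<close> satisfies the constraint
        \<open>m\<close> too, and those in \<open>I\<close> persist because \<open>v\<close> and
        \<open>x\<close> both satisfy them.\<close>
      define s where "s = (\<Sum>j\<in>J. a m j * v j) / (\<Sum>j\<in>J. a m j * x j)"
      have lin: "(\<Sum>j\<in>J. b j * (v j - s * x j)) = (\<Sum>j\<in>J. b j * v j) - s * (\<Sum>j\<in>J. b j * x j)" for b
        by (simp add: algebra_simps sum_subtractf sum_distrib_left)
      have *: "(\<Sum>j\<in>J. w j * (v j - s * x j)) = 0"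
      proof (rule insert.prems(1))
        fix i assume "i \<in> insert m I"
        then show "(\<Sum>j\<in>J. a i j * (v j - s * x j)) = 0"
          unfolding lin using v x mx by (auto simp: s_def)
      qed
      show "(\<Sum>j\<in>J. (w j - c * a m j) * v j) = 0"
      proof -
        have "(\<Sum>j\<in>J. (w j - c * a m j) * v j) = (\<Sum>j\<in>J. w j * v j) - c * (\<Sum>j\<in>J. a m j * v j)"
          by (simp add: left_diff_distrib sum_subtractf mult.assoc sum_distrib_left)
        with * show ?thesis unfolding lin by (simp add: s_def c_def mult.commute)
      qed
    qed (use insert in auto)
    then obtain u where u: "\<forall>j\<in>J. w j - c * a m j = (\<Sum>i\<in>I. u i * a i j)" by blast
    have "w j = (\<Sum>i\<in>insert m I. (u(m := c)) i * a i j)" if "j \<in> J" for j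
    proof -
      have "(\<Sum>i\<in>I. (u(m := c)) i * a i j) = (\<Sum>i\<in>I. u i * a i j)"
        using insert.hyps by (intro sum.cong) auto
      then show ?thesis using u that insert.hyps by (auto simp: sum.insert algebra_simps)
    qed
    then show ?thesis by blast
  qed
qed

text \<open>Apply \<open>functional_in_span\<close> row by row: each row of \<open>B\<close>
  vanishes on the common kernel of the rows of \<open>A\<close>, and its coefficients over these
  rows form the matching row of \<open>K\<close>.\<close>

lemma mat_factor_of_kernel_subset:
  fixes A B :: "real mat"
  assumes A: "A \<in> carrier_mat n m" and B: "B \<in> carrier_mat p m"
    and ker: "\<And>v. v \<in> carrier_vec m \<Longrightarrow> A *\<^sub>v v = 0\<^sub>v n \<Longrightarrow> B *\<^sub>v v = 0\<^sub>v p"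
  shows "\<exists>K \<in> carrier_mat p n. K * A = B"
proof -
  have "\<exists>u. \<forall>j\<in>{0..<m}. B $$ (r, j) = (\<Sum>i = 0..<n. u i * A $$ (i, j))" if r: "r < p" for r
  proof (rule functional_in_span)
    fix v :: "nat \<Rightarrow> real"
    assume v: "\<And>i. i \<in> {0..<n} \<Longrightarrow> (\<Sum>j = 0..<m. A $$ (i, j) * v j) = 0"
    have "B *\<^sub>v vec m v = 0\<^sub>v p"
      by (rule ker) (use v A in \<open>auto simp: scalar_prod_def intro!: eq_vecI\<close>)
    then have "(B *\<^sub>v vec m v) $ r = 0" using r by simp
    then show "(\<Sum>j = 0..<m. B $$ (r, j) * v j) = 0"
      using r B by (auto simp: scalar_prod_def)
  qed auto
  then obtain u where u: "\<And>r j. r < p \<Longrightarrow> j < m \<Longrightarrow> B $$ (r, j) = (\<Sum>i = 0..<n. u r i * A $$ (i, j))"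
    by (metis atLeastLessThan_iff zero_le)
  have "mat p n (\<lambda>(r, i). u r i) * A = B"
    by (rule eq_matI) (use A B u in \<open>auto simp: scalar_prod_def\<close>)
  then show ?thesis by (intro bexI[of _ "mat p n (\<lambda>(r, i). u r i)"]) auto
qed

section \<open>Isotropic vectors, congruences and sums of semidefinite matrices\<close>

text \<open>Move from \<open>x\<close> in the direction \<open>z = A x\<close>: the form becomes a
  quadratic in the step \<open>s\<close> with no constant term and linear coefficient
  \<open>2 N\<close>, where \<open>N\<close> is the squared length of \<open>z\<close>. It stays
  nonnegative for all \<open>s\<close> only if \<open>N = 0\<close>.\<close>

lemma psd_cone_kernel:
  assumes A: "A \<in> psd_cone n" and x: "x \<in> carrier_vec n" and 0: "x \<bullet> (A *\<^sub>v x) = 0"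
  shows "A *\<^sub>v x = 0\<^sub>v n"
proof -
  have Ac: "A \<in> carrier_mat n n" and At: "transpose_mat A = A"
    and pos: "\<And>x. x \<in> carrier_vec n \<Longrightarrow> x \<bullet> (A *\<^sub>v x) \<ge> 0"
    using A by (auto simp: psd_cone_def)
  define z where "z = A *\<^sub>v x"
  have z: "z \<in> carrier_vec n" using Ac x by (simp add: z_def)
  have Az: "A *\<^sub>v z \<in> carrier_vec n" using Ac z by simp
  define N where "N = z \<bullet> z"
  define c where "c = z \<bullet> (A *\<^sub>v z)"
  have c0: "c \<ge> 0" using pos[OF z] by (simp add: c_def)
  have xAz: "x \<bullet> (A *\<^sub>v z) = N"
    using transpose_vec_mult_scalar[OF Ac z x] At by (simp add: z_def N_def)
  have q: "2 * s * N + s * s * c \<ge> 0" for s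
  proof -
    have "(x + s \<cdot>\<^sub>v z) \<bullet> (A *\<^sub>v (x + s \<cdot>\<^sub>v z)) = (x + s \<cdot>\<^sub>v z) \<bullet> (z + s \<cdot>\<^sub>v (A *\<^sub>v z))"
      using Ac x z by (simp add: mult_add_distrib_mat_vec mult_mat_vec z_def[symmetric])
    also have "\<dots> = x \<bullet> z + s * N + (s * N + s * s * c)"
      using x z Az xAz
      by (simp add: add_scalar_prod_distrib[of _ n] scalar_prod_add_distrib[of _ n] N_def c_def algebra_simps)
    finally show ?thesis using pos[of "x + s \<cdot>\<^sub>v z"] x z 0 by (simp add: z_def ac_simps)
  qed
  have N0: "N \<ge> 0" unfolding N_def scalar_prod_def by (intro sum_nonneg) auto
  have "N = 0"
  proof (rule ccontr)
    assume "N \<noteq> 0"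
    then have "N > 0" using N0 by simp
    \<comment> \<open>A negative step short enough for the linear term to win; the
      \<open>+ 1\<close> keeps the denominator positive when \<open>c = 0\<close>.\<close>
    define s where "s = - N / (c + 1)"
    have "2 * s * N + s * s * c = - (N * N) * (c + 2) / ((c + 1) * (c + 1))"
      unfolding s_def using c0 by (simp add: divide_simps) (simp add: algebra_simps)
    moreover have "N * N * (c + 2) / ((c + 1) * (c + 1)) > 0"
      using \<open>N > 0\<close> c0 by (intro divide_pos_pos mult_pos_pos) auto
    ultimately show False using q[of s] by simp
  qed
  then have "\<forall>i\<in>{0..<dim_vec z}. z $ i * z $ i = 0"
    unfolding N_def scalar_prod_def by (subst (asm) sum_nonneg_eq_0_iff) auto
  then have "z $ i = 0" if "i < n" for i using z that by simp
  then have "z = 0\<^sub>v n" using z by (intro eq_vecI) auto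
  then show ?thesis by (simp add: z_def)
qed

text \<open>Serves both summands of the lifted matrix and, with 0-1 matrices for \<open>B\<close>,
  the passage to principal submatrices and back.\<close>

lemma psd_cone_congruence:
  assumes A: "A \<in> psd_cone n" and B: "B \<in> carrier_mat m n"
  shows "B * A * transpose_mat B \<in> psd_cone m"
proof -
  have Ac: "A \<in> carrier_mat n n" and At: "transpose_mat A = A"
    and pos: "\<And>x. x \<in> carrier_vec n \<Longrightarrow> x \<bullet> (A *\<^sub>v x) \<ge> 0"
    using A by (auto simp: psd_cone_def)
  have "transpose_mat (B * A * transpose_mat B) = B * A * transpose_mat B"
    using Ac B At by (simp add: transpose_mult[of _ m n _ m] transpose_mult[of _ n n _ m])
  moreover have "x \<bullet> (B * A * transpose_mat B *\<^sub>v x) \<ge> 0" if x: "x \<in> carrier_vec m" for x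
  proof -
    define y where "y = transpose_mat B *\<^sub>v x"
    have y: "y \<in> carrier_vec n" using B x by (simp add: y_def)
    have "x \<bullet> (B * A * transpose_mat B *\<^sub>v x) = x \<bullet> (B *\<^sub>v (A *\<^sub>v y))"
      using B Ac x by (simp add: y_def assoc_mult_mat_vec[of _ m n _ m] assoc_mult_mat_vec[of _ m n _ n])
    also have "\<dots> = y \<bullet> (A *\<^sub>v y)"
      using transpose_vec_mult_scalar[OF B _ x, of "A *\<^sub>v y"] Ac y by (simp add: y_def)
    finally show ?thesis using pos[OF y] by simp
  qed
  ultimately show ?thesis using Ac B by (auto simp: psd_cone_def)
qed

lemma psd_cone_add:
  assumes "A \<in> psd_cone n" "B \<in> psd_cone n"
  shows "A + B \<in> psd_cone n"
  using assms
  by (auto simp: psd_cone_def transpose_add[of _ n n] add_mult_distrib_mat_vec[of _ n n]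
      scalar_prod_add_distrib[of _ n])

subsection \<open>Schur complements\<close>

text \<open>\<open>M - outer v\<close> is the Schur complement of the corner entry 1 in
  \<open>bordered v M\<close>.\<close>

definition outer :: "real vec \<Rightarrow> real mat" where
  "outer v = mat (dim_vec v) (dim_vec v) (\<lambda>(i, j). v $ i * v $ j)"

lemma outer_carrier [simp]: "outer v \<in> carrier_mat n n \<longleftrightarrow> v \<in> carrier_vec n"
  unfolding outer_def carrier_mat_def carrier_vec_def by simp

lemma outer_dim [simp]: "dim_row (outer v) = dim_vec v" "dim_col (outer v) = dim_vec v"
  by (simp_all add: outer_def)

lemma transpose_outer [simp]: "transpose_mat (outer v) = outer v"
  by (rule eq_matI) (auto simp: outer_def)

lemma outer_mult_vec:
  assumes "v \<in> carrier_vec n" "x \<in> carrier_vec n"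
  shows "outer v *\<^sub>v x = (v \<bullet> x) \<cdot>\<^sub>v v"
proof (rule eq_vecI)
  fix i assume "i < dim_vec ((v \<bullet> x) \<cdot>\<^sub>v v)"
  then have i: "i < n" using assms by simp
  then have "(outer v *\<^sub>v x) $ i = (\<Sum>j = 0..<n. v $ i * v $ j * x $ j)"
    using assms by (simp add: outer_def scalar_prod_def)
  also have "\<dots> = (v \<bullet> x) * v $ i"
    using assms by (simp add: scalar_prod_def sum_distrib_left ac_simps)
  finally show "(outer v *\<^sub>v x) $ i = ((v \<bullet> x) \<cdot>\<^sub>v v) $ i"
    using assms i by simp
qed (use assms in \<open>simp_all add: outer_def\<close>)

lemma outer_mult_mat_vec:
  assumes "B \<in> carrier_mat m n" "v \<in> carrier_vec n"
  shows "outer (B *\<^sub>v v) = B * outer v * transpose_mat B"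
proof (rule eq_matI)
  fix i j assume "i < dim_row (B * outer v * transpose_mat B)" "j < dim_col (B * outer v * transpose_mat B)"
  then have ij: "i < m" "j < m" using assms by auto
  have "(B * outer v * transpose_mat B) $$ (i, j)
      = (\<Sum>q = 0..<n. (\<Sum>p = 0..<n. B $$ (i, p) * (v $ p * v $ q)) * B $$ (j, q))"
    using assms ij by (auto simp: outer_def scalar_prod_def)
  also have "\<dots> = (\<Sum>p = 0..<n. B $$ (i, p) * v $ p) * (\<Sum>q = 0..<n. B $$ (j, q) * v $ q)"
    by (subst sum_product, subst sum.swap) (simp add: sum_distrib_left sum_distrib_right ac_simps)
  finally show "outer (B *\<^sub>v v) $$ (i, j) = (B * outer v * transpose_mat B) $$ (i, j)"
    using assms ij by (auto simp: outer_def scalar_prod_def)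
qed (use assms in \<open>auto simp: outer_def\<close>)

lemma bordered_carrier:
  assumes "v \<in> carrier_vec n" "M \<in> carrier_mat n n"
  shows "bordered v M \<in> carrier_mat (n + 1) (n + 1)"
  using assms by (auto simp: bordered_def)

text \<open>Complete the square in the border coordinate \<open>c\<close>; what remains is the form
  of the Schur complement.\<close>

lemma bordered_quadratic_form:
  assumes v: "v \<in> carrier_vec n" and M: "M \<in> carrier_mat n n" and z: "z \<in> carrier_vec n"
  shows "(vec 1 (\<lambda>_. c) @\<^sub>v z) \<bullet> (bordered v M *\<^sub>v (vec 1 (\<lambda>_. c) @\<^sub>v z))
    = (c + v \<bullet> z)\<^sup>2 + z \<bullet> ((M - outer v) *\<^sub>v z)"
proof -
  have Mz: "M *\<^sub>v z \<in> carrier_vec n" using M z by simp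
  have 1: "1\<^sub>m 1 *\<^sub>v vec 1 (\<lambda>_. c) + mat_of_row v *\<^sub>v z = vec 1 (\<lambda>_. c + v \<bullet> z)"
    using v by (intro eq_vecI) (auto simp: scalar_prod_def)
  have 2: "transpose_mat (mat_of_row v) *\<^sub>v vec 1 (\<lambda>_. c) = c \<cdot>\<^sub>v v"
    using v by (intro eq_vecI) (auto simp: scalar_prod_def)
  have "bordered v M *\<^sub>v (vec 1 (\<lambda>_. c) @\<^sub>v z) = vec 1 (\<lambda>_. c + v \<bullet> z) @\<^sub>v (c \<cdot>\<^sub>v v + M *\<^sub>v z)"
    unfolding bordered_def 1[symmetric] 2[symmetric]
    by (rule four_block_mat_mult_vec) (use v M z in auto)
  then have "(vec 1 (\<lambda>_. c) @\<^sub>v z) \<bullet> (bordered v M *\<^sub>v (vec 1 (\<lambda>_. c) @\<^sub>v z))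
     = vec 1 (\<lambda>_. c) \<bullet> vec 1 (\<lambda>_. c + v \<bullet> z) + z \<bullet> (c \<cdot>\<^sub>v v + M *\<^sub>v z)"
    using scalar_prod_append[of "vec 1 (\<lambda>_. c)" 1 z n "vec 1 (\<lambda>_. c + v \<bullet> z)" "c \<cdot>\<^sub>v v + M *\<^sub>v z"] v z Mz
    by simp
  also have "\<dots> = c * (c + v \<bullet> z) + (c * (v \<bullet> z) + z \<bullet> (M *\<^sub>v z))"
    using v z Mz comm_scalar_prod[OF v z]
    by (simp add: scalar_prod_add_distrib[of _ n]) (simp add: scalar_prod_def)
  also have "\<dots> = (c + v \<bullet> z)\<^sup>2 + z \<bullet> ((M - outer v) *\<^sub>v z)"
    using v z M Mz comm_scalar_prod[OF v z]
    by (simp add: minus_mult_distrib_mat_vec[of _ n n] outer_mult_vec scalar_prod_minus_distrib[of _ n]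
        power2_eq_square algebra_simps)
  finally show ?thesis .
qed

text \<open>The symmetry conditions agree because the border and \<open>outer v\<close> are
  symmetric by themselves. The sign conditions are compared through the completed square.\<close>

lemma bordered_psd_iff:
  assumes v: "v \<in> carrier_vec n" and M: "M \<in> carrier_mat n n"
  shows "bordered v M \<in> psd_cone (n + 1) \<longleftrightarrow> M - outer v \<in> psd_cone n"
proof -
  have "transpose_mat (bordered v M) = bordered v (transpose_mat M)"
    unfolding bordered_def using v M
    by (subst transpose_four_block_mat[of _ 1 1 _ n _ n]) auto
  moreover have "bordered v (transpose_mat M) = bordered v M \<longleftrightarrow> transpose_mat M = M"
  proof
    assume eq: "bordered v (transpose_mat M) = bordered v M"
    show "transpose_mat M = M"
    proof (rule eq_matI)
      fix i j assume ij: "i < dim_row M" "j < dim_col M"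
      \<comment> \<open>\<open>Suc\<close> skips the border row and column.\<close>
      have "bordered v (transpose_mat M) $$ (Suc i, Suc j) = bordered v M $$ (Suc i, Suc j)"
        by (simp only: eq)
      then show "transpose_mat M $$ (i, j) = M $$ (i, j)"
        using ij v M by (auto simp: bordered_def)
    qed (use M in auto)
  qed simp
  moreover have "transpose_mat (M - outer v) = M - outer v \<longleftrightarrow> transpose_mat M = M"
  proof -
    have "transpose_mat (M - outer v) = transpose_mat M - outer v"
      using M v by (simp add: transpose_minus[of _ n n])
    moreover have "transpose_mat M = M" if "transpose_mat M - outer v = M - outer v"
    proof -
      have "transpose_mat M - outer v + outer v = M - outer v + outer v" using that by simp
      moreover have "X - outer v + outer v = X" if "X \<in> carrier_mat n n" for X
        using that v by (intro eq_matI) (auto simp: outer_def)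
      ultimately show ?thesis using M by simp
    qed
    ultimately show ?thesis by auto
  qed
  moreover have "(\<forall>x \<in> carrier_vec (n + 1). x \<bullet> (bordered v M *\<^sub>v x) \<ge> 0)
     \<longleftrightarrow> (\<forall>z \<in> carrier_vec n. z \<bullet> ((M - outer v) *\<^sub>v z) \<ge> 0)" (is "?L = ?R")
  proof
    assume L: ?L
    show ?R
    proof
      fix z :: "real vec" assume z: "z \<in> carrier_vec n"
      \<comment> \<open>This border coordinate cancels the square and leaves only the Schur
        complement term.\<close>
      have "vec 1 (\<lambda>_. - (v \<bullet> z)) @\<^sub>v z \<in> carrier_vec (n + 1)"
        by (rule append_carrier_vec[of _ 1 _ n, unfolded add.commute[of 1]]) (use z in auto)
      from bspec[OF L this] have "(- (v \<bullet> z) + v \<bullet> z)\<^sup>2 + z \<bullet> ((M - outer v) *\<^sub>v z) \<ge> 0"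
        by (simp only: bordered_quadratic_form[OF v M z])
      then show "z \<bullet> ((M - outer v) *\<^sub>v z) \<ge> 0" by simp
    qed
  next
    assume R: ?R
    show ?L
    proof
      fix x :: "real vec" assume x: "x \<in> carrier_vec (n + 1)"
      define z where "z = vec n (\<lambda>i. x $ Suc i)"
      have z: "z \<in> carrier_vec n" by (simp add: z_def)
      have "x = vec 1 (\<lambda>_. x $ 0) @\<^sub>v z"
        using x by (intro eq_vecI) (auto simp: z_def)
      then have "x \<bullet> (bordered v M *\<^sub>v x) = (x $ 0 + v \<bullet> z)\<^sup>2 + z \<bullet> ((M - outer v) *\<^sub>v z)"
        using bordered_quadratic_form[OF v M z, of "x $ 0"] by simp
      then show "x \<bullet> (bordered v M *\<^sub>v x) \<ge> 0" using R z by simp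
    qed
  qed
  moreover have "M - outer v \<in> carrier_mat n n"
    using v by (intro minus_carrier_mat) simp
  ultimately show ?thesis
    using bordered_carrier[OF v M] by (simp add: psd_cone_def)
qed

subsection \<open>Block diagonal parts\<close>

text \<open>Partitions are encoded by labels: \<open>f\<close> names the block of a row,
  \<open>g\<close> that of a column. Block diagonal shape becomes the equation
  \<open>block_part f g A = A\<close>, without any reordering of indices.\<close>

definition block_part :: "(nat \<Rightarrow> nat) \<Rightarrow> (nat \<Rightarrow> nat) \<Rightarrow> real mat \<Rightarrow> real mat" where
  "block_part f g A = mat (dim_row A) (dim_col A) (\<lambda>(i, j). if f i = g j then A $$ (i, j) else 0)"

lemma block_part_carrier [simp]:
  "block_part f g A \<in> carrier_mat m n \<longleftrightarrow> A \<in> carrier_mat m n"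
  unfolding block_part_def carrier_mat_def by simp

lemma block_part_dim [simp]:
  "dim_row (block_part f g A) = dim_row A" "dim_col (block_part f g A) = dim_col A"
  by (auto simp: block_part_def)

lemma block_part_index [simp]:
  "i < dim_row A \<Longrightarrow> j < dim_col A \<Longrightarrow>
    block_part f g A $$ (i, j) = (if f i = g j then A $$ (i, j) else 0)"
  by (simp add: block_part_def)

lemma block_part_idem [simp]: "block_part f g (block_part f g A) = block_part f g A"
  by (rule eq_matI) auto

lemma transpose_block_part: "transpose_mat (block_part f g A) = block_part g f (transpose_mat A)"
  by (rule eq_matI) auto

lemma block_part_minus:
  assumes "A \<in> carrier_mat m n" "B \<in> carrier_mat m n"
  shows "block_part f g (A - B) = block_part f g A - block_part f g B"
  by (rule eq_matI) (use assms in auto)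

lemma block_part_add:
  assumes "A \<in> carrier_mat m n" "B \<in> carrier_mat m n"
  shows "block_part f g (A + B) = block_part f g A + block_part f g B"
  by (rule eq_matI) (use assms in auto)

text \<open>A nonzero \<open>A $$ (i, q)\<close> forces \<open>f i = g q\<close>, so cutting the
  product by \<open>f i = h j\<close> is the same as cutting \<open>B\<close> by
  \<open>g q = h j\<close>.\<close>

lemma block_part_mult_left:
  assumes A: "A \<in> carrier_mat m n" "block_part f g A = A" and B: "B \<in> carrier_mat n p"
  shows "block_part f h (A * B) = A * block_part g h B"
proof (rule eq_matI)
  fix i j assume "i < dim_row (A * block_part g h B)" "j < dim_col (A * block_part g h B)"
  then have ij: "i < m" "j < p" using assms by auto
  have A0: "A $$ (i, q) = 0" if "f i \<noteq> g q" "q < n" for q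
    using that ij A block_part_index[of i A q f g] by auto
  have "(\<Sum>q = 0..<n. A $$ (i, q) * block_part g h B $$ (q, j))
      = (if f i = h j then \<Sum>q = 0..<n. A $$ (i, q) * B $$ (q, j) else 0)"
    using A0 B ij by (auto intro!: sum.cong sum.neutral)
  then show "block_part f h (A * B) $$ (i, j) = (A * block_part g h B) $$ (i, j)"
    using assms ij by (auto simp: scalar_prod_def)
qed (use assms in auto)

text \<open>The transpose of \<open>block_part_mult_left\<close>.\<close>

lemma block_part_mult_right:
  assumes A: "A \<in> carrier_mat m n" and B: "B \<in> carrier_mat n p" "block_part g h B = B"
  shows "block_part f h (A * B) = block_part f g A * B"
proof -
  have "block_part h g (transpose_mat B) = transpose_mat B"
    using B(2) by (metis transpose_block_part)
  then have "block_part h f (transpose_mat B * transpose_mat A) = transpose_mat B * block_part g f (transpose_mat A)"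
    using A B by (intro block_part_mult_left[of _ p n _ _ _ m]) auto
  then have "transpose_mat (block_part f h (A * B)) = transpose_mat (block_part f g A * B)"
    using A B by (simp add: transpose_block_part transpose_mult[of _ m n _ p])
  then show ?thesis by simp
qed

lemma block_part_congruence:
  assumes P: "P \<in> carrier_mat k d" "block_part f g P = P" and A: "A \<in> carrier_mat d d"
  shows "block_part f f (P * A * transpose_mat P) = P * block_part g g A * transpose_mat P"
proof -
  have "block_part g f (transpose_mat P) = transpose_mat P"
    using P(2) by (metis transpose_block_part)
  then have "block_part f f (P * A * transpose_mat P) = block_part f g (P * A) * transpose_mat P"
    using P A by (intro block_part_mult_right[of _ k d]) auto
  then show ?thesis using block_part_mult_left[OF P A] by simp
qed

section \<open>Lifting a semidefinite matrix through a block diagonal \<open>P\<close>\<close>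

text \<open>If \<open>P D P^T\<close> kills \<open>v\<close>, then \<open>x = P^T v\<close> is
  isotropic for \<open>D\<close>, hence in its kernel; this is the kernel inclusion that yields a
  factor. One possible \<open>K\<close> is \<open>D P^T\<close> times the pseudoinverse of
  \<open>P D P^T\<close>.\<close>

lemma psd_congruence_factor:
  assumes D: "D \<in> psd_cone d" and P: "P \<in> carrier_mat k d"
  shows "\<exists>K \<in> carrier_mat d k. K * (P * D * transpose_mat P) = D * transpose_mat P"
proof (rule mat_factor_of_kernel_subset)
  have Dc: "D \<in> carrier_mat d d" using D by (simp add: psd_cone_def)
  show "P * D * transpose_mat P \<in> carrier_mat k k" "D * transpose_mat P \<in> carrier_mat d k"
    using P Dc by auto
  fix v :: "real vec" assume v: "v \<in> carrier_vec k" and 0: "P * D * transpose_mat P *\<^sub>v v = 0\<^sub>v k"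
  define x where "x = transpose_mat P *\<^sub>v v"
  have x: "x \<in> carrier_vec d" using P v by (simp add: x_def)
  have "P *\<^sub>v (D *\<^sub>v x) = 0\<^sub>v k"
    using 0 P Dc v by (simp add: x_def assoc_mult_mat_vec[of _ k d _ k] assoc_mult_mat_vec[of _ d d _ k])
  then have "x \<bullet> (D *\<^sub>v x) = 0"
    using transpose_vec_mult_scalar[OF P _ v, of "D *\<^sub>v x"] Dc x v by (simp add: x_def)
  then have "D *\<^sub>v x = 0\<^sub>v d" by (rule psd_cone_kernel[OF D x])
  then show "D * transpose_mat P *\<^sub>v v = 0\<^sub>v d"
    using P Dc v by (simp add: x_def assoc_mult_mat_vec[of _ d d _ k])
qed

text \<open>\<open>M Z M\<^sup>T\<close> and \<open>M (block_part f f Z) M\<^sup>T\<close> have the same diagonal, so every row of \<open>M\<close> is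
  isotropic for \<open>Z\<close> and therefore lies in its kernel.\<close>

lemma psd_mult_zero_of_block_part:
  assumes M: "M \<in> carrier_mat k k" "block_part f f M = M" and Z: "Z \<in> psd_cone k"
    and 0: "M * block_part f f Z = 0\<^sub>m k k"
  shows "M * Z = 0\<^sub>m k k"
proof -
  have Zc: "Z \<in> carrier_mat k k" and Zt: "transpose_mat Z = Z" using Z by (auto simp: psd_cone_def)
  have "block_part f f (M * Z * transpose_mat M) = M * block_part f f Z * transpose_mat M"
    using block_part_congruence[OF M Zc] .
  then have b: "block_part f f (M * Z * transpose_mat M) = 0\<^sub>m k k"
    unfolding 0 using M by simp
  have c: "col (Z * transpose_mat M) i = Z *\<^sub>v row M i" if "i < k" for i
    using M Zc that by (intro eq_vecI) auto
  have *: "Z *\<^sub>v row M i = 0\<^sub>v k" if i: "i < k" for i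
  proof (rule psd_cone_kernel[OF Z])
    show r: "row M i \<in> carrier_vec k" using M i by auto
    have "(M * Z * transpose_mat M) $$ (i, i) = 0"
      using arg_cong[OF b, of "\<lambda>X. X $$ (i, i)"] M Zc i by simp
    moreover have "(M * Z * transpose_mat M) $$ (i, i) = (M * (Z * transpose_mat M)) $$ (i, i)"
      using M Zc by (simp add: assoc_mult_mat[of _ k k _ k _ k])
    moreover have "\<dots> = row M i \<bullet> col (Z * transpose_mat M) i"
      using M Zc i by simp
    ultimately show "row M i \<bullet> (Z *\<^sub>v row M i) = 0" using c[OF i] by simp
  qed
  have "Z * transpose_mat M = 0\<^sub>m k k"
  proof (intro mat_col_eqI)
    fix i assume "i < dim_col (0\<^sub>m k k :: real mat)"
    then have i: "i < k" by simp
    show "col (Z * transpose_mat M) i = col (0\<^sub>m k k) i"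
      unfolding c[OF i] using * i by simp
  qed (use M Zc in auto)
  then have "transpose_mat (Z * transpose_mat M) = 0\<^sub>m k k" by simp
  then show ?thesis using M Zc Zt by (simp add: transpose_mult[of _ k k _ k])
qed

lemma mat_eq_of_minus_zero:
  fixes A B :: "'a :: group_add mat"
  assumes "A \<in> carrier_mat m n" "B \<in> carrier_mat m n" and 0: "A - B = 0\<^sub>m m n"
  shows "A = B"
proof (rule eq_matI)
  fix i j assume "i < dim_row B" "j < dim_col B"
  then show "A $$ (i, j) = B $$ (i, j)"
    using arg_cong[OF 0, of "\<lambda>X. X $$ (i, j)"] assms(1,2) by simp
qed (use assms in auto)

text \<open>Here \<open>Z\<close> is the global Schur complement and \<open>D\<close> collects the
  local ones. \<open>K Z K^T\<close> carries the off-diagonal blocks of \<open>Z\<close>, and a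
  correction \<open>R\<close> repairs the diagonal blocks without being seen by \<open>P\<close>,
  since \<open>P R P^T = W - W\<close>.\<close>

lemma psd_block_lift:
  assumes P: "P \<in> carrier_mat k d" "block_part f g P = P"
    and D: "D \<in> psd_cone d" "block_part g g D = D"
    and Z: "Z \<in> psd_cone k" "block_part f f Z = P * D * transpose_mat P"
  shows "\<exists>S \<in> psd_cone d. P * S * transpose_mat P = Z \<and> block_part g g S = D"
proof -
  have Dc: "D \<in> carrier_mat d d" and Dt: "transpose_mat D = D" using D by (auto simp: psd_cone_def)
  have Zc: "Z \<in> carrier_mat k k" and Zt: "transpose_mat Z = Z" using Z by (auto simp: psd_cone_def)
  define W where "W = block_part f f Z"
  have Wc: "W \<in> carrier_mat k k" using Zc by (simp add: W_def)
  have Wt: "transpose_mat W = W" using Zt by (simp add: W_def transpose_block_part)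
  have PDP: "P * (D * transpose_mat P) = W"
    using Z(2) P Dc by (simp add: W_def assoc_mult_mat[of _ k d _ d _ k])
  have Pt: "block_part g f (transpose_mat P) = transpose_mat P"
    using P(2) by (metis transpose_block_part)
  obtain K0 where K0: "K0 \<in> carrier_mat d k" "K0 * W = D * transpose_mat P"
    using psd_congruence_factor[OF D(1) P(1)] Z(2) by (auto simp: W_def)
  \<comment> \<open>\<open>K0\<close> may have entries off the blocks. Truncating it keeps the
    equation, as \<open>W\<close> and \<open>D P^T\<close> are both block diagonal.\<close>
  define K where "K = block_part g f K0"
  have K: "K \<in> carrier_mat d k" "block_part g f K = K" using K0 by (auto simp: K_def)
  have Wb: "block_part f f W = W" by (simp add: W_def)
  have "K * W = block_part g f (K0 * W)"
    unfolding K_def using block_part_mult_right[OF K0(1) Wc Wb] by simp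
  also have "\<dots> = block_part g g D * transpose_mat P"
    unfolding K0(2) using block_part_mult_right[OF Dc _ Pt] P by simp
  finally have KW: "K * W = D * transpose_mat P" using D by simp
  have KWt: "W * transpose_mat K = P * D"
  proof -
    have "transpose_mat (K * W) = transpose_mat (D * transpose_mat P)" by (simp add: KW)
    then show ?thesis using K Wc Wt P Dc Dt
      by (simp add: transpose_mult[of _ d k _ k] transpose_mult[of _ d d _ k])
  qed
  \<comment> \<open>\<open>M\<close> is block diagonal and kills \<open>W\<close>, the block part of
    \<open>Z\<close>; \<open>psd_mult_zero_of_block_part\<close> then makes it kill \<open>Z\<close>
    as well.\<close>
  define M where "M = P * K - 1\<^sub>m k"
  have PKc: "P * K \<in> carrier_mat k k" using P K by simp
  have M: "M \<in> carrier_mat k k" unfolding M_def by (intro minus_carrier_mat) simp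
  have "block_part f f (P * K) = P * K" using block_part_mult_left[OF P K(1)] K(2) by simp
  moreover have "block_part f f (1\<^sub>m k) = 1\<^sub>m k" by (rule eq_matI) auto
  ultimately have Mb: "block_part f f M = M"
    unfolding M_def using block_part_minus[OF PKc one_carrier_mat] by simp
  have PKW: "P * K * W = W"
    using P K Wc KW PDP by (simp add: assoc_mult_mat[of _ k d _ k _ k])
  have "M * W = 0\<^sub>m k k"
    unfolding M_def using PKc Wc PKW by (simp add: minus_mult_distrib_mat[of _ k k _ _ k])
  then have "M * Z = 0\<^sub>m k k"
    using psd_mult_zero_of_block_part[OF M Mb Z(1)] by (simp add: W_def)
  then have "P * K * Z - Z = 0\<^sub>m k k"
    unfolding M_def using PKc Zc by (simp add: minus_mult_distrib_mat[of _ k k _ _ k])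
  then have PKZ: "P * K * Z = Z"
    using mat_eq_of_minus_zero[of "P * K * Z" k k Z] PKc Zc by simp
  \<comment> \<open>The difference form exposes the diagonal blocks and the image under
    \<open>P\<close>; semidefiniteness comes from the factored form proved below.\<close>
  define R where "R = D - K * W * transpose_mat K"
  define S where "S = K * Z * transpose_mat K + R"
  have KWKc: "K * W * transpose_mat K \<in> carrier_mat d d" using K Wc by simp
  have KZKc: "K * Z * transpose_mat K \<in> carrier_mat d d" using K Zc by simp
  have Rc: "R \<in> carrier_mat d d" unfolding R_def by (rule minus_carrier_mat[OF KWKc])
  have "R = (1\<^sub>m d - K * P) * D * transpose_mat (1\<^sub>m d - K * P)"
  proof -
    let ?X = "K * W * transpose_mat K"
    have KP: "K * P \<in> carrier_mat d d" and PK: "transpose_mat P * transpose_mat K \<in> carrier_mat d d"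
      using K P by auto
    \<comment> \<open>Expanding the factored form gives \<open>D\<close> minus two cross terms plus
      a quadratic term. All three equal \<open>?X\<close>, so \<open>D - ?X\<close> is left.\<close>
    have 1: "K * P * D = ?X"
      using K P Dc Wc KWt by (simp add: assoc_mult_mat[of _ d k _ d _ d] assoc_mult_mat[of _ d k _ k _ d])
    have 2: "D * (transpose_mat P * transpose_mat K) = ?X"
      unfolding KW using K P Dc by (intro assoc_mult_mat[symmetric]) auto
    have "?X * (transpose_mat P * transpose_mat K) = K * P * (D * (transpose_mat P * transpose_mat K))"
      unfolding 1[symmetric] using KP Dc PK by (rule assoc_mult_mat)
    also have "\<dots> = K * (P * ?X)"
      unfolding 2 using K P KWKc by (intro assoc_mult_mat) auto
    also have "P * ?X = P * K * W * transpose_mat K"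
      using K P Wc by (simp add: assoc_mult_mat[of _ k d _ k _ k] assoc_mult_mat[of _ k d _ k _ d] assoc_mult_mat[of _ d k _ k _ d])
    also have "K * (P * K * W * transpose_mat K) = ?X"
      unfolding PKW using K Wc by (simp add: assoc_mult_mat[of _ d k _ k _ d])
    finally have 3: "?X * (transpose_mat P * transpose_mat K) = ?X" .
    have t: "transpose_mat (1\<^sub>m d - K * P) = 1\<^sub>m d - transpose_mat P * transpose_mat K"
      using transpose_minus[OF one_carrier_mat KP] transpose_mult[OF K(1) P(1)] by simp
    have c: "D - ?X \<in> carrier_mat d d" by (rule minus_carrier_mat[OF KWKc])
    have "(1\<^sub>m d - K * P) * D = D - ?X"
      using minus_mult_distrib_mat[OF one_carrier_mat KP Dc] 1 Dc by simp
    then have "(1\<^sub>m d - K * P) * D * transpose_mat (1\<^sub>m d - K * P)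
        = (D - ?X) - (D - ?X) * (transpose_mat P * transpose_mat K)"
      unfolding t using mult_minus_distrib_mat[OF c one_carrier_mat PK] right_mult_one_mat[OF c] by simp
    also have "(D - ?X) * (transpose_mat P * transpose_mat K) = ?X - ?X"
      using minus_mult_distrib_mat[OF Dc KWKc PK] 2 3 by simp
    also have "(D - ?X) - (?X - ?X) = D - ?X"
      using Dc KWKc by (intro eq_matI) auto
    finally show ?thesis by (simp add: R_def)
  qed
  then have Rpsd: "R \<in> psd_cone d"
    using psd_cone_congruence[OF D(1), of "1\<^sub>m d - K * P" d] K P by (simp add: minus_carrier_mat)
  have "S \<in> psd_cone d"
    unfolding S_def using psd_cone_add psd_cone_congruence[OF Z(1) K(1)] Rpsd by blast
  moreover have "P * S * transpose_mat P = Z"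
  proof -
    \<comment> \<open>Transposing \<open>P K X = X\<close> for symmetric \<open>X\<close> gives
      \<open>X K^T P^T = X\<close>, so \<open>P\<close> undoes the congruence by \<open>K\<close>.
      Both \<open>Z\<close> and \<open>W\<close> are of this kind.\<close>
    have absorb: "P * (K * X * transpose_mat K) * transpose_mat P = X"
      if X: "X \<in> carrier_mat k k" "transpose_mat X = X" "P * K * X = X" for X
    proof -
      have "transpose_mat (P * K * X) = X * (transpose_mat K * transpose_mat P)"
        using transpose_mult[OF PKc X(1)] transpose_mult[OF P(1) K(1)] X(2) by simp
      then have r: "X * (transpose_mat K * transpose_mat P) = X" using X by simp
      have "P * (K * X * transpose_mat K) * transpose_mat P = P * (K * X * transpose_mat K * transpose_mat P)"
        using P K X by (intro assoc_mult_mat[of _ k d _ d _ k]) auto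
      also have "K * X * transpose_mat K * transpose_mat P = K * X * (transpose_mat K * transpose_mat P)"
        using P K X by (intro assoc_mult_mat[of _ d k _ d _ k]) auto
      also have "\<dots> = K * X"
        using r P K X by (subst assoc_mult_mat[of _ d k _ k _ k]) auto
      also have "P * (K * X) = X"
        using P K X by (subst assoc_mult_mat[of _ k d _ k _ k, symmetric]) auto
      finally show ?thesis .
    qed
    have Ptc: "transpose_mat P \<in> carrier_mat d k" using P by simp
    have "P * S = P * (K * Z * transpose_mat K) + (P * D - P * (K * W * transpose_mat K))"
      unfolding S_def mult_add_distrib_mat[OF P(1) KZKc Rc]
      unfolding R_def mult_minus_distrib_mat[OF P(1) Dc KWKc] ..
    then have "P * S * transpose_mat P = P * (K * Z * transpose_mat K) * transpose_mat P
        + (P * D * transpose_mat P - P * (K * W * transpose_mat K) * transpose_mat P)"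
      using P Dc KZKc KWKc Ptc
      by (simp only: add_mult_distrib_mat[of _ k d _ _ k] minus_mult_distrib_mat[of _ k d _ _ k]
          mult_carrier_mat minus_carrier_mat)
    also have "\<dots> = Z + (W - W)"
      using absorb[OF Zc Zt PKZ] absorb[OF Wc Wt PKW] Z(2) by (simp add: W_def)
    also have "\<dots> = Z" using Zc Wc by (intro eq_matI) auto
    finally show ?thesis .
  qed
  moreover have "block_part g g S = D"
  proof -
    \<comment> \<open>The diagonal blocks of \<open>K Z K^T\<close> are those of
      \<open>K W K^T\<close>, exactly what \<open>R\<close> subtracts from \<open>D\<close>.\<close>
    have "block_part g g (K * Z * transpose_mat K) = K * W * transpose_mat K"
      using block_part_congruence[OF K Zc] by (simp add: W_def)
    moreover have "block_part g g (K * W * transpose_mat K) = K * W * transpose_mat K"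
      using block_part_congruence[OF K Wc] Wb by simp
    ultimately have "block_part g g S = K * W * transpose_mat K + (D - K * W * transpose_mat K)"
      unfolding S_def R_def block_part_add[OF KZKc Rc[unfolded R_def]] block_part_minus[OF Dc KWKc]
      by (simp add: D(2))
    also have "\<dots> = D" using Dc KWKc by (intro eq_matI) auto
    finally show ?thesis .
  qed
  ultimately show ?thesis by blast
qed

subsection \<open>Submatrices and cells of a partition\<close>

text \<open>The number of elements of \<open>I\<close> below \<open>pick I i\<close> is
  \<open>i\<close>, which gives injectivity; equal cardinalities give surjectivity.\<close>

lemma bij_betw_pick:
  assumes "finite I"
  shows "bij_betw (pick I) {0..<card I} I"
proof -
  have "inj_on (pick I) {0..<card I}"
    by (rule inj_onI) (metis atLeastLessThan_iff card_pick_le)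
  moreover have "pick I ` {0..<card I} \<subseteq> I"
    by (auto intro: pick_in_set_le)
  ultimately show ?thesis
    using assms by (simp add: bij_betw_def card_image card_subset_eq)
qed

lemma sum_pick:
  assumes "finite I"
  shows "(\<Sum>i = 0..<card I. h (pick I i)) = sum h I"
  using sum.reindex_bij_betw[OF bij_betw_pick[OF assms]] .

lemma Collect_less_mem: "I \<subseteq> {0..<n} \<Longrightarrow> {i. i < n \<and> i \<in> I} = I"
  by auto

lemma submatrix_carrier:
  assumes "A \<in> carrier_mat m n" "I \<subseteq> {0..<m}" "J \<subseteq> {0..<n}"
  shows "submatrix A I J \<in> carrier_mat (card I) (card J)"
  using assms by (intro carrier_matI) (simp_all add: dim_submatrix Collect_less_mem)

lemma submatrix_pick:
  assumes "A \<in> carrier_mat m n" "I \<subseteq> {0..<m}" "J \<subseteq> {0..<n}" "i < card I" "j < card J"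
  shows "submatrix A I J $$ (i, j) = A $$ (pick I i, pick J j)"
  using assms by (intro submatrix_index) (auto simp: Collect_less_mem)

lemma subvec_carrier:
  assumes "v \<in> carrier_vec n" "I \<subseteq> {0..<n}"
  shows "subvec v I \<in> carrier_vec (card I)"
  using assms by (intro carrier_vecI) (simp add: subvec_def Collect_less_mem)

lemma subvec_index:
  assumes "v \<in> carrier_vec n" "I \<subseteq> {0..<n}" "i < card I"
  shows "subvec v I $ i = v $ pick I i"
  using assms by (simp add: subvec_def Collect_less_mem)

lemma pick_less:
  assumes "I \<subseteq> {0..<n}" "i < card I"
  shows "pick I i < n"
  using assms pick_in_set_le[of i I] by auto

text \<open>Schur complements commute with restriction to an index set. This links the local
  bordered matrices to the diagonal blocks of a global Schur complement.\<close>

lemma submatrix_minus_outer: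
  assumes "A \<in> carrier_mat n n" "v \<in> carrier_vec n" "I \<subseteq> {0..<n}"
  shows "submatrix (A - outer v) I I = submatrix A I I - outer (subvec v I)"
  by (rule eq_matI)
    (use assms pick_less[OF assms(3)] in \<open>auto simp: submatrix_def subvec_def outer_def Collect_less_mem\<close>)

section \<open>Principal submatrices as congruences\<close>

text \<open>The rows are the unit vectors indexed by \<open>I\<close>. Congruence by this matrix
  extracts a principal submatrix; congruence by its transpose puts one back, padded with
  zeros.\<close>

definition selection_mat :: "nat \<Rightarrow> nat set \<Rightarrow> real mat" where
  "selection_mat n I = mat (card I) n (\<lambda>(i, j). if j = pick I i then 1 else 0)"

lemma submatrix_eq_congruence:
  assumes A: "A \<in> carrier_mat n n" and I: "I \<subseteq> {0..<n}"
  shows "submatrix A I I = selection_mat n I * A * transpose_mat (selection_mat n I)"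
proof (rule eq_matI)
  fix i j assume "i < dim_row (selection_mat n I * A * transpose_mat (selection_mat n I))"
    "j < dim_col (selection_mat n I * A * transpose_mat (selection_mat n I))"
  then have ij: "i < card I" "j < card I" by (auto simp: selection_mat_def)
  then have p: "pick I i < n" "pick I j < n" using pick_less[OF I] by auto
  have "(selection_mat n I * A * transpose_mat (selection_mat n I)) $$ (i, j)
      = (\<Sum>b = 0..<n. (\<Sum>a = 0..<n. (if a = pick I i then 1 else 0) * A $$ (a, b)) * (if b = pick I j then 1 else 0))"
    using A ij by (simp add: selection_mat_def scalar_prod_def)
  also have "\<dots> = A $$ (pick I i, pick I j)"
    using p by (simp add: if_distrib[of "\<lambda>x. x * _"] if_distrib[of "\<lambda>x. _ * x"] cong: if_cong)
  finally show "submatrix A I I $$ (i, j) = (selection_mat n I * A * transpose_mat (selection_mat n I)) $$ (i, j)"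
    using submatrix_pick[OF A I I ij] by simp
qed (use submatrix_carrier[OF A I I] in \<open>auto simp: selection_mat_def\<close>)

lemma psd_cone_submatrix:
  assumes "A \<in> psd_cone n" "I \<subseteq> {0..<n}"
  shows "submatrix A I I \<in> psd_cone (card I)"
  using assms psd_cone_congruence[OF assms(1), of "selection_mat n I" "card I"]
  by (subst submatrix_eq_congruence) (auto simp: psd_cone_def selection_mat_def)

lemma psd_cone_extend_zero:
  assumes A: "A \<in> carrier_mat n n" and I: "I \<subseteq> {0..<n}" and S: "submatrix A I I \<in> psd_cone (card I)"
  shows "mat n n (\<lambda>(a, b). if a \<in> I \<and> b \<in> I then A $$ (a, b) else 0) \<in> psd_cone n"
proof -
  have fin: "finite I" using I finite_subset by blast
  let ?E = "transpose_mat (selection_mat n I)"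
  have E: "?E \<in> carrier_mat n (card I)" by (simp add: selection_mat_def)
  have "mat n n (\<lambda>(a, b). if a \<in> I \<and> b \<in> I then A $$ (a, b) else 0)
     = ?E * submatrix A I I * transpose_mat ?E" (is "_ = ?R")
  proof (rule eq_matI)
    fix a b assume "a < dim_row ?R" "b < dim_col ?R"
    then have ab: "a < n" "b < n" by (auto simp: selection_mat_def)
    have "?R $$ (a, b) = (\<Sum>j = 0..<card I. (\<Sum>i = 0..<card I.
         (if a = pick I i then 1 else 0) * A $$ (pick I i, pick I j)) * (if b = pick I j then 1 else 0))"
      using ab A I submatrix_carrier[OF A I I] submatrix_pick[OF A I I]
      by (simp add: selection_mat_def scalar_prod_def)
    \<comment> \<open>Reindexing positions by \<open>pick\<close> turns the sums into sums over
      \<open>I\<close>, where each indicator leaves at most one term.\<close>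
    also have "\<dots> = (\<Sum>q\<in>I. (\<Sum>p\<in>I. (if a = p then 1 else 0) * A $$ (p, q)) * (if b = q then 1 else 0))"
      by (simp only: sum_pick[OF fin, of "\<lambda>p. (if a = p then 1 else 0) * A $$ (p, _)"]
        sum_pick[OF fin, of "\<lambda>q. (\<Sum>p\<in>I. (if a = p then 1 else 0) * A $$ (p, q)) * (if b = q then 1 else 0)"])
    also have "\<dots> = (if a \<in> I \<and> b \<in> I then A $$ (a, b) else 0)"
      using fin by (simp add: if_distrib[of "\<lambda>x. x * _"] if_distrib[of "\<lambda>x. _ * x"] cong: if_cong)
    finally show "mat n n (\<lambda>(a, b). if a \<in> I \<and> b \<in> I then A $$ (a, b) else 0) $$ (a, b) = ?R $$ (a, b)"
      using ab by simp
  qed (auto simp: selection_mat_def)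
  then show ?thesis using psd_cone_congruence[OF S E] by simp
qed

text \<open>The block part is the sum of its diagonal blocks, each extended by zero, so
  semidefiniteness follows by adding one label at a time.\<close>

lemma psd_cone_block_part:
  assumes A: "A \<in> carrier_mat n n" and g: "\<And>a. a < n \<Longrightarrow> g a < l"
    and S: "\<And>i. i < l \<Longrightarrow>
      submatrix A {a. a < n \<and> g a = i} {a. a < n \<and> g a = i} \<in> psd_cone (card {a. a < n \<and> g a = i})"
  shows "block_part g g A \<in> psd_cone n"
proof -
  \<comment> \<open>The partial sum over labels below \<open>m\<close>: zero for
    \<open>m = 0\<close>, and the whole block part for \<open>m = l\<close> because all labels are
    below \<open>l\<close>.\<close>
  let ?B = "\<lambda>m. mat n n (\<lambda>(a, b). if g a = g b \<and> g a < m then A $$ (a, b) else 0)"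
  have "?B m \<in> psd_cone n" if "m \<le> l" for m
    using that
  proof (induction m)
    case 0
    have "?B 0 = 0\<^sub>m n n" by (rule eq_matI) auto
    moreover have "0\<^sub>m n n *\<^sub>v x = 0\<^sub>v n" if "x \<in> carrier_vec n" for x :: "real vec"
      using that by (intro eq_vecI) auto
    then have "0\<^sub>m n n \<in> psd_cone n" unfolding psd_cone_def by auto
    ultimately show ?case by (simp only:)
  next
    case (Suc m)
    let ?I = "{a. a < n \<and> g a = m}"
    have "mat n n (\<lambda>(a, b). if a \<in> ?I \<and> b \<in> ?I then A $$ (a, b) else 0) \<in> psd_cone n"
      by (rule psd_cone_extend_zero[OF A]) (use S Suc in auto)
    moreover have "?B (Suc m) = ?B m + mat n n (\<lambda>(a, b). if a \<in> ?I \<and> b \<in> ?I then A $$ (a, b) else 0)"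
      by (rule eq_matI) (auto simp: less_Suc_eq)
    ultimately show ?case using psd_cone_add Suc by simp
  qed
  moreover have "block_part g g A = ?B l"
    by (rule eq_matI) (use A g in auto)
  ultimately show ?thesis by simp
qed

section \<open>Partitions as labellings\<close>

abbreviation cell :: "nat \<Rightarrow> (nat \<Rightarrow> nat) \<Rightarrow> nat \<Rightarrow> nat set" where
  "cell n f i \<equiv> {a. a < n \<and> f a = i}"

lemma cell_subset: "cell n f i \<subseteq> {0..<n}"
  by auto

lemma indexed_partition_labels:
  assumes "indexed_partition {0..<n} l \<alpha>"
  obtains f where "\<And>a. a < n \<Longrightarrow> f a < l" "\<And>i. i < l \<Longrightarrow> \<alpha> i = cell n f i"
proof -
  have cover: "\<Union> (\<alpha> ` {..<l}) = {0..<n}" and disj: "disjoint (\<alpha> ` {..<l})" and inj: "inj_on \<alpha> {..<l}"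
    using assms by (auto simp: indexed_partition_def partition_on_def)
  \<comment> \<open>Disjointness concerns distinct sets; injectivity of \<open>\<alpha>\<close>
    turns equality of sets into equality of indices.\<close>
  have uniq: "i = j" if "i < l" "j < l" "a \<in> \<alpha> i" "a \<in> \<alpha> j" for a i j
    using disjointD[OF disj, of "\<alpha> i" "\<alpha> j"] inj_onD[OF inj, of i j] that by auto
  have "\<exists>i<l. a \<in> \<alpha> i" if "a < n" for a
  proof -
    have "a \<in> \<Union> (\<alpha> ` {..<l})" unfolding cover using that by simp
    then show ?thesis by auto
  qed
  then obtain f where f: "\<And>a. a < n \<Longrightarrow> f a < l \<and> a \<in> \<alpha> (f a)" by metis
  have "a < n" if "i < l" "a \<in> \<alpha> i" for a i
  proof -
    have "a \<in> \<Union> (\<alpha> ` {..<l})" using that by auto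
    then show ?thesis unfolding cover by simp
  qed
  then have "a \<in> \<alpha> i \<longleftrightarrow> a < n \<and> f a = i" if "i < l" for a i
    using f[of a] uniq[of i "f a" a] that by auto
  then have "\<alpha> i = cell n f i" if "i < l" for i
    using that by auto
  then show thesis using f by (intro that[of f]) auto
qed

text \<open>An entry whose row and column labels differ lies in one of the vanishing submatrices, at
  the position given by the ranks of its indices in their cells.\<close>

lemma separable_block_part:
  assumes P: "P \<in> carrier_mat k d" and sep: "separable P l \<alpha> \<beta>"
    and f: "\<And>a. a < k \<Longrightarrow> f a < l" "\<And>i. i < l \<Longrightarrow> \<alpha> i = cell k f i"
    and g: "\<And>a. a < d \<Longrightarrow> g a < l" "\<And>i. i < l \<Longrightarrow> \<beta> i = cell d g i"
  shows "block_part f g P = P"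
proof (rule eq_matI)
  fix a b assume "a < dim_row P" "b < dim_col P"
  then have ab: "a < k" "b < d" using P by auto
  have "P $$ (a, b) = 0" if neq: "f a \<noteq> g b"
  proof -
    let ?I = "cell k f (f a)" and ?J = "cell d g (g b)"
    have 0: "submatrix P ?I ?J = 0\<^sub>m (card ?I) (card ?J)"
    proof -
      have "submatrix P (\<alpha> (f a)) (\<beta> (g b)) = 0\<^sub>m (card (\<alpha> (f a))) (card (\<beta> (g b)))"
        using sep f(1)[OF ab(1)] g(1)[OF ab(2)] neq by (auto simp: separable_def)
      then show ?thesis unfolding f(2)[OF f(1)[OF ab(1)]] g(2)[OF g(1)[OF ab(2)]] .
    qed
    \<comment> \<open>The rank of an element omits the element itself, so it is a valid position in
      the zero matrix.\<close>
    have lt: "card {x \<in> ?I. x < a} < card ?I" "card {x \<in> ?J. x < b} < card ?J"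
      using ab by (auto intro!: psubset_card_mono)
    have "P $$ (a, b) = submatrix P ?I ?J $$ (card {x \<in> ?I. x < a}, card {x \<in> ?J. x < b})"
      by (rule submatrix_index_card[symmetric]) (use P ab in auto)
    then show ?thesis unfolding 0 using lt by simp
  qed
  then show "block_part f g P $$ (a, b) = P $$ (a, b)" using P ab by simp
qed auto

section \<open>Products with a block diagonal matrix, restricted to cells\<close>

lemma submatrix_transpose:
  assumes "A \<in> carrier_mat m n" "I \<subseteq> {0..<m}" "J \<subseteq> {0..<n}"
  shows "submatrix (transpose_mat A) J I = transpose_mat (submatrix A I J)"
  by (rule eq_matI)
    (use assms pick_less[OF assms(2)] pick_less[OF assms(3)] in \<open>auto simp: submatrix_def Collect_less_mem\<close>)

text \<open>Row \<open>a\<close> of \<open>P\<close> is supported on the column cell with its own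
  label; \<open>pick\<close> then numbers that cell.\<close>

lemma block_row_sum:
  fixes h :: "nat \<Rightarrow> real"
  assumes P: "P \<in> carrier_mat k d" "block_part f g P = P" and a: "a < k" "f a = i"
  shows "(\<Sum>b = 0..<d. P $$ (a, b) * h b)
    = (\<Sum>j = 0..<card (cell d g i). P $$ (a, pick (cell d g i) j) * h (pick (cell d g i) j))"
proof -
  have P0: "P $$ (a, b) = 0" if "g b \<noteq> i" "b < d" for b
    using that a P block_part_index[of a P b f g] by auto
  have "(\<Sum>b = 0..<d. P $$ (a, b) * h b) = (\<Sum>b\<in>cell d g i. P $$ (a, b) * h b)"
    using P0 by (intro sum.mono_neutral_right) auto
  then show ?thesis
    by (subst sum_pick[of _ "\<lambda>b. P $$ (a, b) * h b"]) auto
qed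

lemma submatrix_block_mult:
  assumes P: "P \<in> carrier_mat k d" "block_part f g P = P"
    and X: "X \<in> carrier_mat d n" and J: "J \<subseteq> {0..<n}"
  shows "submatrix (P * X) (cell k f i) J
    = submatrix P (cell k f i) (cell d g i) * submatrix X (cell d g i) J" (is "?L = ?R")
proof (rule eq_matI)
  have PX: "P * X \<in> carrier_mat k n" using P X by simp
  note c = submatrix_carrier[OF PX cell_subset[of k f i] J]
    submatrix_carrier[OF P(1) cell_subset[of k f i] cell_subset[of d g i]]
    submatrix_carrier[OF X cell_subset[of d g i] J]
  show "dim_row ?L = dim_row ?R" "dim_col ?L = dim_col ?R"
    using c by auto
  fix r s assume "r < dim_row ?R" "s < dim_col ?R"
  then have rs: "r < card (cell k f i)" "s < card J"
    using c by auto
  have pr: "pick (cell k f i) r < k" "f (pick (cell k f i) r) = i"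
    using pick_in_set_le[OF rs(1)] by auto
  have ps: "pick J s < n" using pick_less[OF J rs(2)] .
  have "?L $$ (r, s) = (\<Sum>b = 0..<d. P $$ (pick (cell k f i) r, b) * X $$ (b, pick J s))"
    using submatrix_pick[OF PX cell_subset J rs] P X pr ps by (simp add: scalar_prod_def)
  also have "\<dots> = (\<Sum>j = 0..<card (cell d g i).
      P $$ (pick (cell k f i) r, pick (cell d g i) j) * X $$ (pick (cell d g i) j, pick J s))"
    by (rule block_row_sum[OF P pr])
  also have "\<dots> = (\<Sum>j = 0..<card (cell d g i).
      submatrix P (cell k f i) (cell d g i) $$ (r, j) * submatrix X (cell d g i) J $$ (j, s))"
    using submatrix_pick[OF P(1) cell_subset cell_subset rs(1)]
      submatrix_pick[OF X cell_subset J _ rs(2)] by (intro sum.cong) auto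
  also have "\<dots> = ?R $$ (r, s)"
    using rs c by (simp add: scalar_prod_def)
  finally show "?L $$ (r, s) = ?R $$ (r, s)" .
qed

lemma submatrix_block_congruence:
  assumes P: "P \<in> carrier_mat k d" "block_part f g P = P" and A: "A \<in> carrier_mat d d"
  shows "submatrix (P * A * transpose_mat P) (cell k f i) (cell k f i)
    = submatrix P (cell k f i) (cell d g i) * submatrix A (cell d g i) (cell d g i)
      * transpose_mat (submatrix P (cell k f i) (cell d g i))"
proof -
  let ?I = "cell k f i" and ?J = "cell d g i"
  have APt: "A * transpose_mat P \<in> carrier_mat d k" using A P by simp
  have At: "transpose_mat A \<in> carrier_mat d d" using A by simp
  note sc = submatrix_carrier[OF P(1) cell_subset[of k f i] cell_subset[of d g i]]
    submatrix_carrier[OF A cell_subset[of d g i] cell_subset[of d g i]]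
  \<comment> \<open>Transposition brings the right-hand factor to the left, so that
    \<open>submatrix_block_mult\<close> applies to it too.\<close>
  have "A * transpose_mat P = transpose_mat (P * transpose_mat A)"
    using transpose_mult[OF P(1) At] by simp
  then have "submatrix (A * transpose_mat P) ?J ?I = transpose_mat (submatrix (P * transpose_mat A) ?I ?J)"
    using submatrix_transpose[of "P * transpose_mat A" k d ?I ?J] P At cell_subset by auto
  also have "\<dots> = transpose_mat (submatrix P ?I ?J * transpose_mat (submatrix A ?J ?J))"
    using submatrix_block_mult[OF P At cell_subset] submatrix_transpose[OF A cell_subset cell_subset]
    by simp
  also have "\<dots> = submatrix A ?J ?J * transpose_mat (submatrix P ?I ?J)"
    using transpose_mult[OF sc(1), of "transpose_mat (submatrix A ?J ?J)"] sc by simp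
  finally have 1: "submatrix (A * transpose_mat P) ?J ?I = submatrix A ?J ?J * transpose_mat (submatrix P ?I ?J)" .
  have "submatrix (P * (A * transpose_mat P)) ?I ?I = submatrix P ?I ?J * submatrix (A * transpose_mat P) ?J ?I"
    by (rule submatrix_block_mult[OF P APt cell_subset])
  moreover have "P * A * transpose_mat P = P * (A * transpose_mat P)"
    using P A by (intro assoc_mult_mat) auto
  moreover have "submatrix P ?I ?J * submatrix A ?J ?J * transpose_mat (submatrix P ?I ?J)
      = submatrix P ?I ?J * (submatrix A ?J ?J * transpose_mat (submatrix P ?I ?J))"
    using sc by (intro assoc_mult_mat) auto
  ultimately show ?thesis unfolding 1 by simp
qed

lemma subvec_block_mult:
  assumes P: "P \<in> carrier_mat k d" "block_part f g P = P" and t: "t \<in> carrier_vec d"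
  shows "subvec (P *\<^sub>v t) (cell k f i) = submatrix P (cell k f i) (cell d g i) *\<^sub>v subvec t (cell d g i)"
    (is "?L = ?R")
proof (rule eq_vecI)
  have Pt: "P *\<^sub>v t \<in> carrier_vec k" using P t by simp
  note sc = submatrix_carrier[OF P(1) cell_subset[of k f i] cell_subset[of d g i]]
    subvec_carrier[OF t cell_subset[of d g i]]
  show "dim_vec ?L = dim_vec ?R"
    using sc subvec_carrier[OF Pt cell_subset[of k f i]] by auto
  fix r assume "r < dim_vec ?R"
  then have r: "r < card (cell k f i)" using sc by simp
  have pr: "pick (cell k f i) r < k" "f (pick (cell k f i) r) = i"
    using pick_in_set_le[OF r] by auto
  have "?L $ r = (\<Sum>b = 0..<d. P $$ (pick (cell k f i) r, b) * t $ b)"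
    using subvec_index[OF Pt cell_subset r] P t pr by (simp add: scalar_prod_def)
  also have "\<dots> = (\<Sum>j = 0..<card (cell d g i).
      P $$ (pick (cell k f i) r, pick (cell d g i) j) * t $ pick (cell d g i) j)"
    by (rule block_row_sum[OF P pr])
  also have "\<dots> = (\<Sum>j = 0..<card (cell d g i).
      submatrix P (cell k f i) (cell d g i) $$ (r, j) * subvec t (cell d g i) $ j)"
    using submatrix_pick[OF P(1) cell_subset cell_subset r]
      subvec_index[OF t cell_subset] by (intro sum.cong) auto
  also have "\<dots> = ?R $ r"
    using r sc by (simp add: scalar_prod_def)
  finally show "?L $ r = ?R $ r" .
qed

section \<open>Recovering and assembling matrices from their diagonal blocks\<close>

lemma pick_cell_surj:
  assumes "a < n" "f a = i"
  obtains r where "r < card (cell n f i)" "pick (cell n f i) r = a"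
proof -
  have "a \<in> pick (cell n f i) ` {0..<card (cell n f i)}"
    using bij_betw_pick[of "cell n f i"] assms by (auto simp: bij_betw_def)
  then show thesis using that by auto
qed

text \<open>Two indices with equal labels are both picks from one cell, so the entry can be read off
  a diagonal block.\<close>

lemma block_part_eqI:
  assumes A: "A \<in> carrier_mat n n" and B: "B \<in> carrier_mat n n" and g: "\<And>a. a < n \<Longrightarrow> g a < l"
    and eq: "\<And>i. i < l \<Longrightarrow> submatrix A (cell n g i) (cell n g i) = submatrix B (cell n g i) (cell n g i)"
  shows "block_part g g A = block_part g g B"
proof (rule eq_matI)
  fix a b assume "a < dim_row (block_part g g B)" "b < dim_col (block_part g g B)"
  then have ab: "a < n" "b < n" using B by auto
  have "A $$ (a, b) = B $$ (a, b)" if same: "g a = g b"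
  proof -
    let ?I = "cell n g (g a)"
    obtain r where r: "r < card ?I" "pick ?I r = a" using pick_cell_surj[of a n g "g a"] ab by auto
    obtain s where s: "s < card ?I" "pick ?I s = b" using pick_cell_surj[of b n g "g a"] ab same by auto
    show ?thesis
      using submatrix_pick[OF A cell_subset cell_subset r(1) s(1)]
        submatrix_pick[OF B cell_subset cell_subset r(1) s(1)] eq[OF g[OF ab(1)]] r s by simp
  qed
  then show "block_part g g A $$ (a, b) = block_part g g B $$ (a, b)" using A B ab by simp
qed (use A B in auto)

lemma vec_eq_by_cells:
  assumes u: "u \<in> carrier_vec n" and v: "v \<in> carrier_vec n" and g: "\<And>a. a < n \<Longrightarrow> g a < l"
    and eq: "\<And>i. i < l \<Longrightarrow> subvec u (cell n g i) = subvec v (cell n g i)"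
  shows "u = v"
proof (rule eq_vecI)
  fix a assume "a < dim_vec v"
  then have a: "a < n" using v by simp
  let ?I = "cell n g (g a)"
  obtain r where r: "r < card ?I" "pick ?I r = a" using pick_cell_surj[of a n g "g a"] a by auto
  show "u $ a = v $ a"
    using subvec_index[OF u cell_subset r(1)] subvec_index[OF v cell_subset r(1)] eq[OF g[OF a]] r by simp
qed (use u v in auto)

lemma submatrix_block_part:
  assumes A: "A \<in> carrier_mat n n"
  shows "submatrix (block_part g g A) (cell n g i) (cell n g i) = submatrix A (cell n g i) (cell n g i)"
proof (rule eq_matI)
  let ?I = "cell n g i"
  have B: "block_part g g A \<in> carrier_mat n n" using A by simp
  note sc = submatrix_carrier[OF A cell_subset[of n g i] cell_subset[of n g i]]
    submatrix_carrier[OF B cell_subset[of n g i] cell_subset[of n g i]]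
  show "dim_row (submatrix (block_part g g A) ?I ?I) = dim_row (submatrix A ?I ?I)"
    "dim_col (submatrix (block_part g g A) ?I ?I) = dim_col (submatrix A ?I ?I)"
    using sc by auto
  fix r s assume "r < dim_row (submatrix A ?I ?I)" "s < dim_col (submatrix A ?I ?I)"
  then have rs: "r < card ?I" "s < card ?I" using sc by auto
  show "submatrix (block_part g g A) ?I ?I $$ (r, s) = submatrix A ?I ?I $$ (r, s)"
    using submatrix_pick[OF A cell_subset cell_subset rs] submatrix_pick[OF B cell_subset cell_subset rs]
      pick_in_set_le[OF rs(1)] pick_in_set_le[OF rs(2)] A by simp
qed

lemma assemble_blocks:
  assumes T: "\<And>i. i < l \<Longrightarrow> T i \<in> carrier_mat (card (cell n g i)) (card (cell n g i))"
  obtains A where "A \<in> carrier_mat n n"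
    "\<And>i. i < l \<Longrightarrow> submatrix A (cell n g i) (cell n g i) = T i"
proof
  \<comment> \<open>The rank within the own cell inverts \<open>pick\<close>.\<close>
  let ?rank = "\<lambda>a. card {x \<in> cell n g (g a). x < a}"
  \<comment> \<open>Off the diagonal blocks the entries are arbitrary, possibly read outside the
    range of \<open>T (g a)\<close>; the conclusion speaks of the diagonal blocks alone.\<close>
  let ?A = "mat n n (\<lambda>(a, b). T (g a) $$ (?rank a, ?rank b))"
  show A: "?A \<in> carrier_mat n n" by simp
  fix i assume i: "i < l"
  let ?I = "cell n g i"
  note sc = submatrix_carrier[OF A cell_subset[of n g i] cell_subset[of n g i]]
  show "submatrix ?A ?I ?I = T i"
  proof (rule eq_matI)
    fix r s assume "r < dim_row (T i)" "s < dim_col (T i)"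
    then have rs: "r < card ?I" "s < card ?I" using T[OF i] by auto
    have p: "pick ?I r < n" "g (pick ?I r) = i" "pick ?I s < n" "g (pick ?I s) = i"
      using pick_in_set_le[OF rs(1)] pick_in_set_le[OF rs(2)] by auto
    have "?rank (pick ?I r) = r" "?rank (pick ?I s) = s"
      unfolding p(2,4) using card_pick_le[OF rs(1)] card_pick_le[OF rs(2)] by auto
    then show "submatrix ?A ?I ?I $$ (r, s) = T i $$ (r, s)"
      using submatrix_pick[OF A cell_subset cell_subset rs] p(1,3) by (simp add: p(2,4))
  qed (use sc T[OF i] in auto)
qed

lemma assemble_subvecs:
  assumes t: "\<And>i. i < l \<Longrightarrow> t i \<in> carrier_vec (card (cell n g i))"
  obtains v where "v \<in> carrier_vec n" "\<And>i. i < l \<Longrightarrow> subvec v (cell n g i) = t i"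
proof
  let ?rank = "\<lambda>a. card {x \<in> cell n g (g a). x < a}"
  let ?v = "vec n (\<lambda>a. t (g a) $ ?rank a)"
  show v: "?v \<in> carrier_vec n" by simp
  fix i assume i: "i < l"
  let ?I = "cell n g i"
  note sc = subvec_carrier[OF v cell_subset[of n g i]]
  show "subvec ?v ?I = t i"
  proof (rule eq_vecI)
    fix r assume "r < dim_vec (t i)"
    then have r: "r < card ?I" using t[OF i] by auto
    have p: "pick ?I r < n" "g (pick ?I r) = i"
      using pick_in_set_le[OF r] by auto
    have "?rank (pick ?I r) = r" unfolding p(2) using card_pick_le[OF r] by auto
    then show "subvec ?v ?I $ r = t i $ r"
      using subvec_index[OF v cell_subset r] p(1) by (simp add: p(2))
  qed (use sc t[OF i] in auto)
qed

text \<open>Restricting the Schur complement instead of the bordered matrix avoids shifting indices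
  past the border.\<close>

lemma bordered_submatrix_psd:
  assumes t: "t \<in> carrier_vec n" and T: "T \<in> carrier_mat n n"
    and psd: "bordered t T \<in> psd_cone (n + 1)" and I: "I \<subseteq> {0..<n}"
  shows "bordered (subvec t I) (submatrix T I I) \<in> psd_cone (card I + 1)"
proof -
  have "T - outer t \<in> psd_cone n" using psd bordered_psd_iff[OF t T] by simp
  then have "submatrix T I I - outer (subvec t I) \<in> psd_cone (card I)"
    using psd_cone_submatrix[OF _ I] submatrix_minus_outer[OF T t I] by metis
  then show ?thesis using bordered_psd_iff[OF subvec_carrier[OF t I] submatrix_carrier[OF T I I]] by simp
qed

subsection \<open>Gluing local solutions\<close>

text \<open>Schur complements reduce the task to \<open>psd_block_lift\<close>. The restrictions of
  \<open>t'\<close> and \<open>T'\<close> are exactly the given \<open>t i\<close> and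
  \<open>T i\<close>, so membership in arbitrary sets will carry over.\<close>

lemma glue_blocks:
  assumes P: "P \<in> carrier_mat k d" "block_part f g P = P"
    and f: "\<And>a. a < k \<Longrightarrow> f a < l" and g: "\<And>a. a < d \<Longrightarrow> g a < l"
    and y: "y \<in> carrier_vec k" and Y: "Y \<in> carrier_mat k k" and psd: "bordered y Y \<in> psd_cone (k + 1)"
    and t: "\<And>i. i < l \<Longrightarrow> t i \<in> carrier_vec (card (cell d g i))"
    and T: "\<And>i. i < l \<Longrightarrow> T i \<in> carrier_mat (card (cell d g i)) (card (cell d g i))"
    and YT: "\<And>i. i < l \<Longrightarrow> submatrix Y (cell k f i) (cell k f i)
        = submatrix P (cell k f i) (cell d g i) * T i * transpose_mat (submatrix P (cell k f i) (cell d g i))"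
    and yt: "\<And>i. i < l \<Longrightarrow> subvec y (cell k f i) = submatrix P (cell k f i) (cell d g i) *\<^sub>v t i"
    and psdT: "\<And>i. i < l \<Longrightarrow> bordered (t i) (T i) \<in> psd_cone (card (cell d g i) + 1)"
  shows "\<exists>t' \<in> carrier_vec d. \<exists>T' \<in> carrier_mat d d.
    Y = P * T' * transpose_mat P \<and> y = P *\<^sub>v t' \<and> bordered t' T' \<in> psd_cone (d + 1) \<and>
    (\<forall>i<l. subvec t' (cell d g i) = t i \<and> submatrix T' (cell d g i) (cell d g i) = T i)"
proof -
  obtain t' where t': "t' \<in> carrier_vec d" "\<And>i. i < l \<Longrightarrow> subvec t' (cell d g i) = t i"
    using assemble_subvecs[of l t d g] t by blast
  obtain T0 where T0: "T0 \<in> carrier_mat d d" "\<And>i. i < l \<Longrightarrow> submatrix T0 (cell d g i) (cell d g i) = T i"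
    using assemble_blocks[of l T d g] T by blast
  have oc: "outer t' \<in> carrier_mat d d" using t' by simp
  define M where "M = T0 - outer t'"
  have Mc: "M \<in> carrier_mat d d" unfolding M_def by (rule minus_carrier_mat[OF oc])
  \<comment> \<open>\<open>T0\<close> is controlled only on its diagonal blocks; truncation leaves
    the local Schur complements, whose semidefiniteness is known.\<close>
  define D where "D = block_part g g M"
  have Dpsd: "D \<in> psd_cone d"
    unfolding D_def
  proof (rule psd_cone_block_part[OF Mc g])
    fix i assume i: "i < l"
    have "T i - outer (t i) \<in> psd_cone (card (cell d g i))"
      using psdT[OF i] bordered_psd_iff[OF t[OF i] T[OF i]] by simp
    then show "submatrix M (cell d g i) (cell d g i) \<in> psd_cone (card (cell d g i))"
      unfolding M_def using submatrix_minus_outer[OF T0(1) t'(1) cell_subset, of g i] T0(2)[OF i] t'(2)[OF i]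
      by simp
  qed auto
  have Pt': "P *\<^sub>v t' \<in> carrier_vec k" using P t' by simp
  have yP: "y = P *\<^sub>v t'"
  proof (rule vec_eq_by_cells[OF y Pt' f])
    fix i assume i: "i < l"
    show "subvec y (cell k f i) = subvec (P *\<^sub>v t') (cell k f i)"
      unfolding yt[OF i] subvec_block_mult[OF P t'(1)] t'(2)[OF i] ..
  qed
  have PTc: "P * T0 * transpose_mat P \<in> carrier_mat k k" using P T0 by simp
  have bY: "block_part f f Y = block_part f f (P * T0 * transpose_mat P)"
  proof (rule block_part_eqI[OF Y PTc f])
    fix i assume i: "i < l"
    show "submatrix Y (cell k f i) (cell k f i) = submatrix (P * T0 * transpose_mat P) (cell k f i) (cell k f i)"
      unfolding YT[OF i] submatrix_block_congruence[OF P T0(1)] T0(2)[OF i] ..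
  qed
  have oy: "outer y \<in> carrier_mat k k" using y by simp
  have Zpsd: "Y - outer y \<in> psd_cone k" using psd bordered_psd_iff[OF y Y] by simp
  have oP: "outer y = P * outer t' * transpose_mat P"
    unfolding yP by (rule outer_mult_mat_vec[OF P(1) t'(1)])
  \<comment> \<open>Since \<open>y = P t'\<close>, the rank-one term of \<open>M\<close> is mapped
    to \<open>outer y\<close>. With \<open>bY\<close> this identifies the block part of
    \<open>Y - outer y\<close> as \<open>P D P^T\<close>.\<close>
  have PMP: "P * M * transpose_mat P = P * T0 * transpose_mat P - outer y"
    unfolding oP M_def mult_minus_distrib_mat[OF P(1) T0(1) oc]
    by (rule minus_mult_distrib_mat[of _ k d]) (use P T0 oc in auto)
  have "block_part f f (Y - outer y) = block_part f f (P * M * transpose_mat P)"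
    unfolding PMP block_part_minus[OF Y oy] block_part_minus[OF PTc oy] bY ..
  also have "\<dots> = P * D * transpose_mat P"
    unfolding D_def by (rule block_part_congruence[OF P Mc])
  finally have bZ: "block_part f f (Y - outer y) = P * D * transpose_mat P" .
  have bD: "block_part g g D = D" by (simp add: D_def)
  obtain S where S: "S \<in> psd_cone d" "P * S * transpose_mat P = Y - outer y" "block_part g g S = D"
    using psd_block_lift[OF P Dpsd bD Zpsd bZ] by blast
  have Sc: "S \<in> carrier_mat d d" using S by (simp add: psd_cone_def)
  \<comment> \<open>Chosen so that \<open>S\<close> is the Schur complement of
    \<open>bordered t' T'\<close>.\<close>
  define T' where "T' = S + outer t'"
  have T'c: "T' \<in> carrier_mat d d" using oc by (simp add: T'_def)
  have T'S: "T' - outer t' = S" unfolding T'_def using Sc oc by (intro eq_matI) auto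
  have "P * T' = P * S + P * outer t'"
    unfolding T'_def by (rule mult_add_distrib_mat[OF P(1) Sc oc])
  then have "P * T' * transpose_mat P = P * S * transpose_mat P + P * outer t' * transpose_mat P"
    using P Sc oc by (simp only: add_mult_distrib_mat[of _ k d _ _ k] mult_carrier_mat transpose_carrier_mat)
  also have "\<dots> = (Y - outer y) + outer y" unfolding S(2) oP[symmetric] ..
  also have "\<dots> = Y" using Y oy by (intro eq_matI) auto
  finally have YP: "Y = P * T' * transpose_mat P" by simp
  have "bordered t' T' \<in> psd_cone (d + 1)"
    using bordered_psd_iff[OF t'(1) T'c] S T'S by simp
  moreover have "submatrix T' (cell d g i) (cell d g i) = T i" if i: "i < l" for i
  proof -
    \<comment> \<open>On diagonal blocks \<open>S\<close> agrees with
      \<open>M = T0 - outer t'\<close>, and the rank-one term cancels.\<close>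
    have "block_part g g T' = block_part g g T0"
    proof -
      have "block_part g g T' = block_part g g M + block_part g g (outer t')"
        unfolding T'_def block_part_add[OF Sc oc] S(3) D_def ..
      also have "\<dots> = block_part g g (M + outer t')" by (rule block_part_add[OF Mc oc, symmetric])
      also have "M + outer t' = T0" unfolding M_def using T0 oc by (intro eq_matI) auto
      finally show ?thesis .
    qed
    then show ?thesis
      using submatrix_block_part[OF T'c, of g i] submatrix_block_part[OF T0(1), of g i] T0(2)[OF i] by simp
  qed
  ultimately show ?thesis
    by (intro bexI[of _ t'] bexI[of _ T'] conjI allI impI YP yP) (use t' T'c in simp_all)
qed

text \<open>Both sets range over the same \<open>y\<close> and \<open>Y\<close>, so for each such
  pair the two existence conditions are shown equivalent. Restriction to the blocks gives one
  direction, gluing the other.\<close>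

theorem theorem4p2:
  fixes P :: "real mat" and k d l :: nat
    and \<alpha> \<beta> :: "nat \<Rightarrow> nat set"
    and \<A> :: "nat \<Rightarrow> real mat set"
  assumes P: "P \<in> carrier_mat k d"
    and sep: "separable P l \<alpha> \<beta>"
    and A: "\<And>i. i < l \<Longrightarrow> \<A> i \<subseteq> carrier_mat (card (\<beta> i) + 1) (card (\<beta> i) + 1)"
  shows
    "{bordered y Y | y Y.
        y \<in> carrier_vec k \<and> Y \<in> carrier_mat k k \<and> bordered y Y \<in> psd_cone (k + 1) \<and>
        (\<exists>t \<in> carrier_vec d. \<exists>T \<in> carrier_mat d d.
           Y = P * T * transpose_mat P \<and> y = P *\<^sub>v t \<and>
           bordered t T \<in> psd_cone (d + 1) \<and>
           (\<forall>i<l. bordered (subvec t (\<beta> i)) (submatrix T (\<beta> i) (\<beta> i)) \<in> \<A> i))}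
     =
     {bordered y Y | y Y.
        y \<in> carrier_vec k \<and> Y \<in> carrier_mat k k \<and> bordered y Y \<in> psd_cone (k + 1) \<and>
        (\<exists>(t :: nat \<Rightarrow> real vec) (T :: nat \<Rightarrow> real mat). \<forall>i<l.
           t i \<in> carrier_vec (card (\<beta> i)) \<and>
           T i \<in> carrier_mat (card (\<beta> i)) (card (\<beta> i)) \<and>
           submatrix Y (\<alpha> i) (\<alpha> i) =
             submatrix P (\<alpha> i) (\<beta> i) * T i * transpose_mat (submatrix P (\<alpha> i) (\<beta> i)) \<and>
           subvec y (\<alpha> i) = submatrix P (\<alpha> i) (\<beta> i) *\<^sub>v t i \<and>
           bordered (t i) (T i) \<in> psd_cone (card (\<beta> i) + 1) \<and>
           bordered (t i) (T i) \<in> \<A> i)}"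
proof -
  have dims: "dim_row P = k" "dim_col P = d" using P by auto
  obtain f where f: "\<And>a. a < k \<Longrightarrow> f a < l" "\<And>i. i < l \<Longrightarrow> \<alpha> i = cell k f i"
    using sep indexed_partition_labels[of k l \<alpha>] by (auto simp: separable_def dims)
  obtain g where g: "\<And>a. a < d \<Longrightarrow> g a < l" "\<And>i. i < l \<Longrightarrow> \<beta> i = cell d g i"
    using sep indexed_partition_labels[of d l \<beta>] by (auto simp: separable_def dims)
  have Pb: "block_part f g P = P" by (rule separable_block_part[OF P sep f g])
  have "(\<exists>t \<in> carrier_vec d. \<exists>T \<in> carrier_mat d d.
           Y = P * T * transpose_mat P \<and> y = P *\<^sub>v t \<and>
           bordered t T \<in> psd_cone (d + 1) \<and>
           (\<forall>i<l. bordered (subvec t (\<beta> i)) (submatrix T (\<beta> i) (\<beta> i)) \<in> \<A> i)) \<longleftrightarrow>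
        (\<exists>(t :: nat \<Rightarrow> real vec) (T :: nat \<Rightarrow> real mat). \<forall>i<l.
           t i \<in> carrier_vec (card (\<beta> i)) \<and>
           T i \<in> carrier_mat (card (\<beta> i)) (card (\<beta> i)) \<and>
           submatrix Y (\<alpha> i) (\<alpha> i) =
             submatrix P (\<alpha> i) (\<beta> i) * T i * transpose_mat (submatrix P (\<alpha> i) (\<beta> i)) \<and>
           subvec y (\<alpha> i) = submatrix P (\<alpha> i) (\<beta> i) *\<^sub>v t i \<and>
           bordered (t i) (T i) \<in> psd_cone (card (\<beta> i) + 1) \<and>
           bordered (t i) (T i) \<in> \<A> i)" (is "?G \<longleftrightarrow> ?B")
    if yY: "y \<in> carrier_vec k" "Y \<in> carrier_mat k k" "bordered y Y \<in> psd_cone (k + 1)" for y Y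
  proof
    assume ?G
    then obtain t T where t: "t \<in> carrier_vec d" and T: "T \<in> carrier_mat d d"
      and h: "Y = P * T * transpose_mat P \<and> y = P *\<^sub>v t \<and>
           bordered t T \<in> psd_cone (d + 1) \<and>
           (\<forall>i<l. bordered (subvec t (\<beta> i)) (submatrix T (\<beta> i) (\<beta> i)) \<in> \<A> i)"
      by (elim bexE)
    note Y = h[THEN conjunct1] and y = h[THEN conjunct2, THEN conjunct1]
      and psd = h[THEN conjunct2, THEN conjunct2, THEN conjunct1]
      and inA = h[THEN conjunct2, THEN conjunct2, THEN conjunct2]
    have sub: "\<beta> i \<subseteq> {0..<d}" if "i < l" for i
      unfolding g(2)[OF that] by (rule cell_subset)
    \<comment> \<open>As \<open>P\<close> is block diagonal, only the block of \<open>T\<close> at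
      \<open>\<beta> i\<close> contributes to the block of \<open>Y\<close> at
      \<open>\<alpha> i\<close>.\<close>
    have blockY: "submatrix Y (\<alpha> i) (\<alpha> i) = submatrix P (\<alpha> i) (\<beta> i) * submatrix T (\<beta> i) (\<beta> i)
          * transpose_mat (submatrix P (\<alpha> i) (\<beta> i))" if "i < l" for i
      unfolding Y f(2)[OF that] g(2)[OF that] by (rule submatrix_block_congruence[OF P Pb T])
    have blocky: "subvec y (\<alpha> i) = submatrix P (\<alpha> i) (\<beta> i) *\<^sub>v subvec t (\<beta> i)" if "i < l" for i
      unfolding y f(2)[OF that] g(2)[OF that] by (rule subvec_block_mult[OF P Pb t])
    show ?B
      by (rule exI[of _ "\<lambda>i. subvec t (\<beta> i)"], rule exI[of _ "\<lambda>i. submatrix T (\<beta> i) (\<beta> i)"],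
        rule allI, rule impI)
       (simp only: subvec_carrier[OF t sub] submatrix_carrier[OF T sub sub] blockY blocky
          bordered_submatrix_psd[OF t T psd sub] inA[rule_format] simp_thms)
  next
    assume ?B
    then obtain t T where tT: "\<forall>i<l.
           t i \<in> carrier_vec (card (\<beta> i)) \<and>
           T i \<in> carrier_mat (card (\<beta> i)) (card (\<beta> i)) \<and>
           submatrix Y (\<alpha> i) (\<alpha> i) =
             submatrix P (\<alpha> i) (\<beta> i) * T i * transpose_mat (submatrix P (\<alpha> i) (\<beta> i)) \<and>
           subvec y (\<alpha> i) = submatrix P (\<alpha> i) (\<beta> i) *\<^sub>v t i \<and>
           bordered (t i) (T i) \<in> psd_cone (card (\<beta> i) + 1) \<and>
           bordered (t i) (T i) \<in> \<A> i"
      by (elim exE) (rule that)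
    have "\<exists>t' \<in> carrier_vec d. \<exists>T' \<in> carrier_mat d d.
      Y = P * T' * transpose_mat P \<and> y = P *\<^sub>v t' \<and> bordered t' T' \<in> psd_cone (d + 1) \<and>
      (\<forall>i<l. subvec t' (cell d g i) = t i \<and> submatrix T' (cell d g i) (cell d g i) = T i)"
      by (rule glue_blocks[OF P Pb f(1) g(1) yY]) (use tT f(2) g(2) in simp_all)
    then obtain t' T' where "t' \<in> carrier_vec d" "T' \<in> carrier_mat d d"
      "Y = P * T' * transpose_mat P" "y = P *\<^sub>v t'" "bordered t' T' \<in> psd_cone (d + 1)"
      and r: "\<forall>i<l. subvec t' (cell d g i) = t i \<and> submatrix T' (cell d g i) (cell d g i) = T i"
      by (elim bexE conjE) (rule that)
    \<comment> \<open>The glued data restrict to the local solutions themselves, which lie in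
      \<open>\<A> i\<close>.\<close>
    moreover have "\<forall>i<l. bordered (subvec t' (\<beta> i)) (submatrix T' (\<beta> i) (\<beta> i)) \<in> \<A> i"
      using r tT g(2) by simp
    ultimately show ?G by (intro bexI conjI)
  qed
  then show ?thesis by (simp only: cong: conj_cong)
qed

end
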